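(* Let $A \in \mathbb{R}^{n\times d}$, let $k \ge 1$, let $\epsilon \in (0,1)$ and $c \in \mathbb{R}$, and let $\tilde A \in \mathbb{R}^{n\times m}$ be an $(\epsilon,c,k)$-projection-cost-preserving sketch of $A$. Let $\mathcal{S}_k$ be the set of all orthogonal projection matrices in $\mathbb{R}^{n\times n}$ of rank at most $k$, and let $\mathcal{T}\subseteq \mathcal{S}_k$ be any nonempty subset. If $\gamma \ge 1$ and $\tilde P \in \mathcal{T}$ satisfies $$\|\tilde A - \tilde P \tilde A\|_F^2 \le \gamma\cdot \min_{P\in\mathcal{T}} \|\tilde A - P\tilde A\|_F^2,$$ then $$\|A - \tilde P A\|_F^2 \le \frac{(1+\epsilon)\gamma}{1-\epsilon}\cdot \min_{P\in\mathcal{T}}\|A-PA\|_F^2 + \frac{(1-\gamma)c}{1-\epsilon}.$$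
   Context: $\|M\|_F^2=\sum_{i,j}M_{i,j}^2$ is the squared Frobenius norm. Here $\min_{P\in\mathcal T}$ is read as an infimum if it is not attained. Definition. $\tilde A\in\mathbb{R}^{n\times m}$ is an $(\epsilon,c,k)$-projection-cost-preserving sketch of $A\in\mathbb{R}^{n\times d}$ if, for every orthogonal projection matrix $P\in\mathbb{R}^{n\times n}$ with rank at most $k$, $$(1-\epsilon)\|A-PA\|_F^2\le \|\tilde A-P\tilde A\|_F^2+c\le (1+\epsilon)\|A-PA\|_F^2,$$ where $c$ is a constant independent of $P$ (it may depend on $A,\tilde A,\epsilon,k$). *)

theory Defs
  imports "HOL-Analysis.Analysis"
begin

definition frobenius_sq :: "real ^ 'b ^ 'a \<Rightarrow> real" where
  "frobenius_sq M = (\<Sum>i\<in>UNIV. \<Sum>j\<in>UNIV. (M $ i $ j)\<^sup>2)"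

definition orthogonal_projection_matrix :: "real ^ 'n ^ 'n \<Rightarrow> bool" where
  "orthogonal_projection_matrix P \<longleftrightarrow> P ** P = P \<and> transpose P = P"

definition proj_matrices :: "nat \<Rightarrow> (real ^ 'n ^ 'n) set" where
  "proj_matrices k = {P. orthogonal_projection_matrix P \<and> rank P \<le> k}"

text \<open>Matrices in \<open>n \<times> d\<close> have type \<open>real ^ 'd ^ 'n\<close>. The constant \<open>c\<close> is a parameter and
  hence does not depend on \<open>P\<close>.\<close>

definition projection_cost_preserving_sketch ::
  "real \<Rightarrow> real \<Rightarrow> nat \<Rightarrow> real ^ 'd ^ 'n \<Rightarrow> real ^ 'm ^ 'n \<Rightarrow> bool" where
  "projection_cost_preserving_sketch \<epsilon> c k A A' \<longleftrightarrow>
    (\<forall>P. orthogonal_projection_matrix P \<and> rank P \<le> k \<longrightarrow>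
      (1 - \<epsilon>) * frobenius_sq (A - P ** A) \<le> frobenius_sq (A' - P ** A') + c \<and>
      frobenius_sq (A' - P ** A') + c \<le> (1 + \<epsilon>) * frobenius_sq (A - P ** A))"

end

theory Submission
  imports Defs
begin

text \<open>Write \<open>I\<close> and \<open>I'\<close> for the infima over \<open>T\<close> of the
  costs of \<open>A\<close> and \<open>A'\<close>. The lower sketch inequality at \<open>P'\<close>
  and near-optimality bound \<open>1 - \<epsilon>\<close> times the \<open>A\<close>-cost of
  \<open>P'\<close> by \<open>\<gamma> * I' + c\<close>. The upper one, valid at every
  \<open>P\<close> in \<open>T\<close>, passes to infima as
  \<open>I' + c \<le> (1 + \<epsilon>) * I\<close>. Substituting and dividing by
  \<open>1 - \<epsilon> > 0\<close> gives the claim.\<close>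

lemma frobenius_sq_nonneg: "0 \<le> frobenius_sq M"
  unfolding frobenius_sq_def by (intro sum_nonneg) simp

theorem claim1:
  fixes A :: "real ^ 'd ^ 'n" and A' :: "real ^ 'm ^ 'n"
    and k :: nat and \<epsilon> c \<gamma> :: real
    and T :: "(real ^ 'n ^ 'n) set" and P' :: "real ^ 'n ^ 'n"
  assumes "k \<ge> 1"
    and "0 < \<epsilon>" and "\<epsilon> < 1"
    and "projection_cost_preserving_sketch \<epsilon> c k A A'"
    and "T \<subseteq> proj_matrices k" and "T \<noteq> {}"
    and "\<gamma> \<ge> 1"
    and "P' \<in> T"
    and "frobenius_sq (A' - P' ** A') \<le> \<gamma> * (INF P\<in>T. frobenius_sq (A' - P ** A'))"
  shows "frobenius_sq (A - P' ** A)
    \<le> (1 + \<epsilon>) * \<gamma> / (1 - \<epsilon>) * (INF P\<in>T. frobenius_sq (A - P ** A)) + (1 - \<gamma>) * c / (1 - \<epsilon>)"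
proof -
  define I where "I = (INF P\<in>T. frobenius_sq (A - P ** A))"
  define I' where "I' = (INF P\<in>T. frobenius_sq (A' - P ** A'))"
  have sketch: "(1 - \<epsilon>) * frobenius_sq (A - P ** A) \<le> frobenius_sq (A' - P ** A') + c"
    "frobenius_sq (A' - P ** A') + c \<le> (1 + \<epsilon>) * frobenius_sq (A - P ** A)" if "P \<in> T" for P
    using assms(4,5) that
    unfolding projection_cost_preserving_sketch_def proj_matrices_def by blast+
  \<comment> \<open>The infimum need not be attained, so no minimiser is chosen: dividing by
    \<open>1 + \<epsilon>\<close> makes the left side a lower bound for every \<open>A\<close>-cost
    over \<open>T\<close>.\<close>
  have "(I' + c) / (1 + \<epsilon>) \<le> I"
    unfolding I_def
  proof (rule cINF_greatest)
    show "T \<noteq> {}" by fact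
    fix P assume P: "P \<in> T"
    \<comment> \<open>A real infimum lies below its members only if the family is bounded below;
      here 0 is a bound.\<close>
    have "I' \<le> frobenius_sq (A' - P ** A')"
      unfolding I'_def
      by (rule cINF_lower[OF _ P]) (meson bdd_belowI2 frobenius_sq_nonneg)
    with sketch(2)[OF P] show "(I' + c) / (1 + \<epsilon>) \<le> frobenius_sq (A - P ** A)"
      using \<open>0 < \<epsilon>\<close> by (simp add: pos_divide_le_eq mult.commute)
  qed
  then have "I' + c \<le> (1 + \<epsilon>) * I"
    using \<open>0 < \<epsilon>\<close> by (simp add: pos_divide_le_eq mult.commute)
  \<comment> \<open>Only the sign of \<open>\<gamma>\<close> matters here, so \<open>I' + c\<close>
    and \<open>c\<close> may be negative.\<close>
  then have "\<gamma> * (I' + c) \<le> \<gamma> * ((1 + \<epsilon>) * I)"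
    using \<open>\<gamma> \<ge> 1\<close> by (intro mult_left_mono) auto
  moreover have "(1 - \<epsilon>) * frobenius_sq (A - P' ** A) \<le> \<gamma> * I' + c"
    using sketch(1)[OF \<open>P' \<in> T\<close>] assms(9) unfolding I'_def by linarith
  \<comment> \<open>The additive term arises from
    \<open>\<gamma> * I' + c = \<gamma> * (I' + c) + (1 - \<gamma>) * c\<close>: near-optimality
    scales the sketch cost without its shift \<open>c\<close>.\<close>
  ultimately have "(1 - \<epsilon>) * frobenius_sq (A - P' ** A) \<le> (1 + \<epsilon>) * \<gamma> * I + (1 - \<gamma>) * c"
    by (simp add: algebra_simps)
  then have "frobenius_sq (A - P' ** A) \<le> ((1 + \<epsilon>) * \<gamma> * I + (1 - \<gamma>) * c) / (1 - \<epsilon>)"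
    using \<open>\<epsilon> < 1\<close> by (simp add: pos_le_divide_eq mult.commute)
  then show ?thesis
    unfolding I_def by (simp add: add_divide_distrib)
qed

end
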